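(* Let $\mathbf{k}$ be a commutative ring and $q\in\mathbf{k}$. Let $\alpha\in\mathrm{Comp}$. Then the coproduct $\Delta$ of $\mathrm{QSym}$ satisfies $$\Delta\left(\eta_\alpha^{(q)}\right)=\sum_{\beta,\gamma\in\mathrm{Comp};\ \alpha=\beta\gamma}\eta_\beta^{(q)}\otimes\eta_\gamma^{(q)}.$$
   Context: For an integer $m$, $[m]=\{1,2,\ldots,m\}$ (empty if $m\le 0$). A composition is a finite tuple $\alpha=(\alpha_1,\ldots,\alpha_k)$ of positive integers; its length is $\ell(\alpha)=k$, its size is $|\alpha|=\alpha_1+\cdots+\alpha_k$. $\mathrm{Comp}$ is the set of all compositions (including the empty one), and $\mathrm{Comp}_n$ the set of compositions of size $n$. For two compositions $\beta,\gamma$, $\beta\gamma$ denotes their concatenation (the entries of $\beta$ followed by the entries of $\gamma$). For $\alpha=(\alpha_1,\ldots,\alpha_k)\in\mathrm{Comp}_n$ set $D(\alpha)=\{\alpha_1+\cdots+\alpha_i \mid i\in[k-1]\}\subseteq[n-1]$. $\mathrm{QSym}$ is the Hopf algebra of quasisymmetric functions over $\mathbf{k}$ (a $\mathbf{k}$-subalgebra of $\mathbf{k}[[x_1,x_2,\ldots]]$). It has the $\mathbf{k}$-basis $(M_\alpha)_{\alpha\in\mathrm{Comp}}$ with $M_\alpha=\sum_{i_1<i_2<\cdots<i_\ell}x_{i_1}^{\alpha_1}\cdots x_{i_\ell}^{\alpha_\ell}$ for $\alpha=(\alpha_1,\ldots,\alpha_\ell)$. Its coproduct is the $\mathbf{k}$-linear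 map $\Delta:\mathrm{QSym}\to\mathrm{QSym}\otimes\mathrm{QSym}$ given by $\Delta(M_\alpha)=\sum_{\beta,\gamma\in\mathrm{Comp};\ \alpha=\beta\gamma}M_\beta\otimes M_\gamma$ for all $\alpha\in\mathrm{Comp}$. Set $r:=q+1$. For $\alpha\in\mathrm{Comp}_n$, $\eta_\alpha^{(q)}=\sum_{\beta\in\mathrm{Comp}_n;\ D(\beta)\subseteq D(\alpha)}r^{\ell(\beta)}M_\beta\in\mathrm{QSym}$. *)

theory Defs
  imports "HOL-Library.Poly_Mapping"
begin

section \<open>Compositions\<close>

typedef comp = "{a :: nat list. \<forall>x\<in>set a. 0 < x}"
  morphisms parts Comp
  by (rule exI[of _ "[]"]) simp

setup_lifting type_definition_comp

definition clength :: "comp \<Rightarrow> nat" where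
  "clength \<alpha> = length (parts \<alpha>)"

definition csize :: "comp \<Rightarrow> nat" where
  "csize \<alpha> = sum_list (parts \<alpha>)"

lift_definition cconcat :: "comp \<Rightarrow> comp \<Rightarrow> comp" is "(@)"
  by auto

definition descents :: "comp \<Rightarrow> nat set" where
  "descents \<alpha> = {sum_list (take i (parts \<alpha>)) | i. i \<in> {1..clength \<alpha> - 1}}"

lemma finite_csize_le: "finite {\<alpha>. csize \<alpha> \<le> d}"
proof -
  have len: "length xs \<le> sum_list xs" if "\<forall>x\<in>set xs. 0 < x" for xs :: "nat list"
    using that by (induction xs) auto
  have "parts ` {\<alpha>. csize \<alpha> \<le> d} \<subseteq> {xs. set xs \<subseteq> {..d} \<and> length xs \<le> d}"
  proof clarsimp
    fix \<alpha> assume "csize \<alpha> \<le> d"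
    then have s: "sum_list (parts \<alpha>) \<le> d" by (simp add: csize_def)
    have "x \<le> d" if "x \<in> set (parts \<alpha>)" for x
      using member_le_sum_list[OF that] s by simp
    moreover have "length (parts \<alpha>) \<le> d"
      using len[of "parts \<alpha>"] s parts[of \<alpha>] by simp
    ultimately show "set (parts \<alpha>) \<subseteq> {..d} \<and> length (parts \<alpha>) \<le> d" by auto
  qed
  then have "finite (parts ` {\<alpha>. csize \<alpha> \<le> d})"
    by (rule finite_subset) (simp add: finite_lists_length_le)
  then show ?thesis
    by (rule finite_imageD) (simp add: inj_on_def parts_inject)
qed

lemma finite_same_csize: "finite {\<beta>. csize \<beta> = csize \<alpha> \<and> P \<beta>}"
  by (rule finite_subset[OF _ finite_csize_le[of "csize \<alpha>"]]) auto

lemma csize_cconcat: "csize (cconcat \<beta> \<gamma>) = csize \<beta> + csize \<gamma>"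
  by (simp add: csize_def cconcat.rep_eq)

lemma finite_deconcat: "finite {(\<beta>, \<gamma>). \<alpha> = cconcat \<beta> \<gamma>}"
proof (rule finite_subset)
  show "{(\<beta>, \<gamma>). \<alpha> = cconcat \<beta> \<gamma>} \<subseteq> {\<beta>. csize \<beta> \<le> csize \<alpha>} \<times> {\<beta>. csize \<beta> \<le> csize \<alpha>}"
    by (auto simp: csize_cconcat)
qed (simp add: finite_csize_le)


section \<open>Quasisymmetric functions\<close>

text \<open>
  A monomial in \<open>x\<^sub>1, x\<^sub>2, \<dots>\<close> is given by its exponents, of type \<open>nat \<Rightarrow>\<^sub>0 nat\<close>, with
  \<open>i\<close> standing for the variable \<open>x\<^sub>i\<^sub>+\<^sub>1\<close>. A power series is the function
  taking each monomial to its coefficient.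

  The sort \<open>{comm_ring, comm_monoid_mult}\<close> of the coefficients is that of the commutative
  rings with unity; unlike \<^class>\<open>comm_ring_1\<close> it does not require \<open>0 \<noteq> 1\<close>.
\<close>

type_synonym monomial = "nat \<Rightarrow>\<^sub>0 nat"

definition mono_of :: "nat list \<Rightarrow> nat list \<Rightarrow> monomial" where
  "mono_of is a = sum_list (map2 Poly_Mapping.single is a)"

definition mono_deg :: "monomial \<Rightarrow> nat" where
  "mono_deg m = (\<Sum>i\<in>Poly_Mapping.keys m. Poly_Mapping.lookup m i)"

definition quasisymmetric :: "(monomial \<Rightarrow> 'k::zero) \<Rightarrow> bool" where
  "quasisymmetric f \<longleftrightarrow>
     (\<exists>d. \<forall>m. f m \<noteq> 0 \<longrightarrow> mono_deg m \<le> d) \<and>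
     (\<forall>\<alpha> is js. length is = clength \<alpha> \<and> sorted_wrt (<) is \<and>
                length js = clength \<alpha> \<and> sorted_wrt (<) js \<longrightarrow>
                f (mono_of is (parts \<alpha>)) = f (mono_of js (parts \<alpha>)))"

typedef (overloaded) 'k qsym = "{f :: monomial \<Rightarrow> 'k::zero. quasisymmetric f}"
  morphisms qcoeff Qsym
  by (rule exI[of _ "\<lambda>_. 0"]) (simp add: quasisymmetric_def)

setup_lifting type_definition_qsym

lemma quasisymmetric_zero: "quasisymmetric (\<lambda>_. 0)"
  by (simp add: quasisymmetric_def)

lemma quasisymmetric_map2:
  assumes "quasisymmetric f" "quasisymmetric g" "h 0 0 = 0"
  shows "quasisymmetric (\<lambda>m. h (f m) (g m))"
proof -
  obtain d e where "\<forall>m. f m \<noteq> 0 \<longrightarrow> mono_deg m \<le> d" "\<forall>m. g m \<noteq> 0 \<longrightarrow> mono_deg m \<le> e"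
    using assms by (auto simp: quasisymmetric_def)
  then have "\<forall>m. h (f m) (g m) \<noteq> 0 \<longrightarrow> mono_deg m \<le> max d e"
    using assms(3) by (metis max.coboundedI1 max.coboundedI2)
  moreover have "h (f (mono_of is (parts \<alpha>))) (g (mono_of is (parts \<alpha>))) =
      h (f (mono_of js (parts \<alpha>))) (g (mono_of js (parts \<alpha>)))"
    if "length is = clength \<alpha> \<and> sorted_wrt (<) is \<and> length js = clength \<alpha> \<and> sorted_wrt (<) js"
    for \<alpha> "is" js
    using assms(1,2) that unfolding quasisymmetric_def by metis
  ultimately show ?thesis unfolding quasisymmetric_def by blast
qed

instantiation qsym :: (ab_group_add) ab_group_add
begin

lift_definition zero_qsym :: "'a qsym" is "\<lambda>_. 0"
  by (rule quasisymmetric_zero)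

lift_definition plus_qsym :: "'a qsym \<Rightarrow> 'a qsym \<Rightarrow> 'a qsym" is "\<lambda>f g m. f m + g m"
  by (rule quasisymmetric_map2) simp_all

lift_definition minus_qsym :: "'a qsym \<Rightarrow> 'a qsym \<Rightarrow> 'a qsym" is "\<lambda>f g m. f m - g m"
  by (rule quasisymmetric_map2) simp_all

lift_definition uminus_qsym :: "'a qsym \<Rightarrow> 'a qsym" is "\<lambda>f m. - f m"
  by (rule quasisymmetric_map2[where h = "\<lambda>a _. - a"]) simp_all

instance
  by standard (transfer, simp add: fun_eq_iff algebra_simps)+

end

lift_definition qscale :: "'k::mult_zero \<Rightarrow> 'k qsym \<Rightarrow> 'k qsym" is "\<lambda>c f m. c * f m"
  by (rule quasisymmetric_map2[where h = "\<lambda>a _. _ * a"]) simp_all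

lemma qcoeff_sum: "qcoeff (sum F A) m = (\<Sum>a\<in>A. qcoeff (F a) m)"
  by (induction A rule: infinite_finite_induct) (simp_all add: zero_qsym.rep_eq plus_qsym.rep_eq)

lemma mono_of_props:
  assumes "length is = length a" "sorted_wrt (<) is" "\<forall>x\<in>set a. 0 < x"
  shows "Poly_Mapping.keys (mono_of is a) = set is"
    and "map (Poly_Mapping.lookup (mono_of is a)) is = a"
proof -
  define L where "L is a i = (\<Sum>(j, x)\<leftarrow>zip is a. if j = i then x else 0)"
    for "is" a :: "nat list" and i
  have L_Nil: "L [] [] i = 0" for i
    by (simp add: L_def)
  have L_Cons: "L (j # is) (x # a) i = (if j = i then x else 0) + L is a i" for j x "is" a i
    by (simp add: L_def)
  have lk: "Poly_Mapping.lookup (mono_of is a) i = L is a i" for i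
    using assms(1) by (induction "is" a rule: list_induct2)
      (simp_all add: mono_of_def lookup_add lookup_single when_def L_Nil L_Cons)
  have z: "L is a i = 0" if "length is = length a" "i \<notin> set is" for i "is" a
    using that by (induction "is" a rule: list_induct2) (auto simp: L_Nil L_Cons)
  have m: "map (L is a) is = a"
    using assms(1,2)
  proof (induction "is" a rule: list_induct2)
    case (Cons i "is" x a)
    have "map (L (i # is) (x # a)) is = map (L is a) is"
      using Cons.prems by (intro map_cong) (auto simp: L_Cons)
    then have "map (L (i # is) (x # a)) is = a"
      by (rule trans) (use Cons.IH Cons.prems in auto)
    moreover have "L is a i = 0"
      using Cons.prems by (intro z[OF Cons.hyps]) auto
    ultimately show ?case by (simp add: L_Cons[of i "is" x a i])
  qed simp
  then show eq: "map (Poly_Mapping.lookup (mono_of is a)) is = a"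
    by (simp add: lk cong: map_cong)
  have "Poly_Mapping.lookup (mono_of is a) i \<noteq> 0 \<longleftrightarrow> i \<in> set is" for i
  proof (cases "i \<in> set is")
    case True
    then have "Poly_Mapping.lookup (mono_of is a) i \<in> set (map (Poly_Mapping.lookup (mono_of is a)) is)"
      by simp
    then have "Poly_Mapping.lookup (mono_of is a) i \<in> set a" unfolding eq .
    with True assms(3) show ?thesis by auto
  next
    case False
    then show ?thesis by (simp add: lk z[OF assms(1)])
  qed
  then show "Poly_Mapping.keys (mono_of is a) = set is"
    by (auto simp: in_keys_iff)
qed

definition mono_comp :: "monomial \<Rightarrow> comp" where
  "mono_comp m = Comp (map (Poly_Mapping.lookup m) (sorted_list_of_set (Poly_Mapping.keys m)))"

lemma parts_mono_comp:
  "parts (mono_comp m) = map (Poly_Mapping.lookup m) (sorted_list_of_set (Poly_Mapping.keys m))"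
  unfolding mono_comp_def by (rule Comp_inverse) (auto simp: in_keys_iff)

lemma mono_of_mono_comp:
  "mono_of (sorted_list_of_set (Poly_Mapping.keys m)) (parts (mono_comp m)) = m" (is "?m' = m")
proof (rule poly_mapping_eqI)
  fix k
  let ?l = "sorted_list_of_set (Poly_Mapping.keys m)"
  have p: "Poly_Mapping.keys ?m' = set ?l"
    "map (Poly_Mapping.lookup ?m') ?l = map (Poly_Mapping.lookup m) ?l"
    using mono_of_props[of ?l "parts (mono_comp m)"] parts[of "mono_comp m"]
    by (simp_all add: parts_mono_comp)
  show "Poly_Mapping.lookup ?m' k = Poly_Mapping.lookup m k"
  proof (cases "k \<in> Poly_Mapping.keys m")
    case True then show ?thesis using p(2) by simp
  next
    case False
    then have "k \<notin> Poly_Mapping.keys ?m'" using p(1) by simp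
    with False show ?thesis by (simp add: in_keys_iff)
  qed
qed

lemma mono_comp_mono_of:
  assumes "length is = clength \<alpha>" "sorted_wrt (<) is"
  shows "mono_comp (mono_of is (parts \<alpha>)) = \<alpha>"
    and "sorted_list_of_set (Poly_Mapping.keys (mono_of is (parts \<alpha>))) = is"
    and "mono_deg (mono_of is (parts \<alpha>)) = csize \<alpha>"
proof -
  have p: "Poly_Mapping.keys (mono_of is (parts \<alpha>)) = set is"
    "map (Poly_Mapping.lookup (mono_of is (parts \<alpha>))) is = parts \<alpha>"
    using mono_of_props[of "is" "parts \<alpha>"] assms parts[of \<alpha>] by (simp_all add: clength_def)
  have d: "sorted is" "distinct is"
    using assms(2) by (simp_all add: strict_sorted_iff)
  show s: "sorted_list_of_set (Poly_Mapping.keys (mono_of is (parts \<alpha>))) = is"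
    using d by (simp add: p(1) sorted_list_of_set.idem_if_sorted_distinct)
  show "mono_comp (mono_of is (parts \<alpha>)) = \<alpha>"
    by (simp add: parts_inject[symmetric] parts_mono_comp s p(2))
  show "mono_deg (mono_of is (parts \<alpha>)) = csize \<alpha>"
    unfolding mono_deg_def csize_def p(1) using p(2) d
    by (metis sum_list_distinct_conv_sum_set)
qed

lemma mono_deg_eq: "mono_deg m = csize (mono_comp m)"
  using mono_comp_mono_of(3)[of "sorted_list_of_set (Poly_Mapping.keys m)" "mono_comp m"]
  using mono_of_mono_comp[of m] by (simp add: clength_def parts_mono_comp)

lemma monomial_index_set:
  "{is. length is = clength \<alpha> \<and> sorted_wrt (<) is \<and> mono_of is (parts \<alpha>) = m} =
   (if mono_comp m = \<alpha> then {sorted_list_of_set (Poly_Mapping.keys m)} else {})"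
proof (cases "mono_comp m = \<alpha>")
  case True
  have "length (sorted_list_of_set (Poly_Mapping.keys m)) = clength \<alpha>"
    using arg_cong[OF parts_mono_comp[of m], of length] True by (simp add: clength_def)
  with True mono_of_mono_comp[of m] show ?thesis
    by (auto simp: mono_comp_mono_of dest: mono_comp_mono_of(2))
next
  case False
  then show ?thesis by (auto simp: mono_comp_mono_of)
qed

text \<open>
  The coefficient of a monomial in the formal sum of all
  \<open>x\<^bsub>i\<^sub>1\<^esub>^\<alpha>\<^sub>1 \<cdots> x\<^bsub>i\<^sub>k\<^esub>^\<alpha>\<^sub>k\<close> over \<open>i\<^sub>1 < \<cdots> < i\<^sub>k\<close> is the number of tuples
  \<open>(i\<^sub>1, \<dots>, i\<^sub>k)\<close> giving this monomial, as an element of the ring; the set of these tuples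
  is finite by \<open>monomial_index_set\<close>.
\<close>

lift_definition M :: "comp \<Rightarrow> 'k::{comm_ring, comm_monoid_mult} qsym" is
  "\<lambda>\<alpha> m. \<Sum>is\<in>{is. length is = clength \<alpha> \<and> sorted_wrt (<) is \<and> mono_of is (parts \<alpha>) = m}. 1"
  by (auto simp: quasisymmetric_def monomial_index_set mono_comp_mono_of mono_deg_eq
      intro!: exI[of _ "csize _"])

lemma qcoeff_M: "qcoeff (M \<alpha>) m = (if mono_comp m = \<alpha> then 1 else 0)"
  by (simp add: M.rep_eq monomial_index_set)

text \<open>\<open>M_coord f \<alpha>\<close> is the coefficient of \<open>f\<close> at \<open>x\<^sub>1^\<alpha>\<^sub>1 \<cdots> x\<^sub>k^\<alpha>\<^sub>k\<close>.\<close>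

definition M_coord :: "'k::zero qsym \<Rightarrow> comp \<Rightarrow> 'k" where
  "M_coord f \<alpha> = qcoeff f (mono_of [0..<clength \<alpha>] (parts \<alpha>))"

lemma qcoeff_eq_M_coord: "qcoeff f m = M_coord f (mono_comp m)"
proof -
  have "quasisymmetric (qcoeff f)" using qcoeff[of f] by simp
  then have "qcoeff f (mono_of (sorted_list_of_set (Poly_Mapping.keys m)) (parts (mono_comp m))) =
    qcoeff f (mono_of [0..<clength (mono_comp m)] (parts (mono_comp m)))"
    unfolding quasisymmetric_def
    by (metis (no_types, lifting) clength_def diff_zero length_map length_upt parts_mono_comp
        sorted_list_of_set.strict_sorted_key_list_of_set sorted_wrt_upt map_ident)
  then show ?thesis by (simp add: mono_of_mono_comp M_coord_def)
qed

lemma M_coord_M: "M_coord (M \<beta>) \<alpha> = (if \<alpha> = \<beta> then 1 else 0)"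
  by (simp add: M_coord_def qcoeff_M mono_comp_mono_of)

lemma finite_M_coord: "finite {\<alpha>. M_coord f \<alpha> \<noteq> 0}"
proof -
  obtain d where d: "\<forall>m. qcoeff f m \<noteq> 0 \<longrightarrow> mono_deg m \<le> d"
    using qcoeff[of f] by (auto simp: quasisymmetric_def)
  have "csize \<alpha> \<le> d" if "M_coord f \<alpha> \<noteq> 0" for \<alpha>
    using d that mono_comp_mono_of(3)[of "[0..<clength \<alpha>]" \<alpha>] by (auto simp: M_coord_def)
  then show ?thesis by (intro finite_subset[OF _ finite_csize_le[of d]]) auto
qed

lemma M_expansion:
  fixes f :: "'k::{comm_ring, comm_monoid_mult} qsym"
  shows "f = (\<Sum>\<alpha>\<in>{\<alpha>. M_coord f \<alpha> \<noteq> 0}. qscale (M_coord f \<alpha>) (M \<alpha>))"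
proof -
  have "qcoeff f m = (\<Sum>\<alpha>\<in>{\<alpha>. M_coord f \<alpha> \<noteq> 0}. M_coord f \<alpha> * (if mono_comp m = \<alpha> then 1 else 0))" for m
  proof -
    have "(\<Sum>\<alpha>\<in>{\<alpha>. M_coord f \<alpha> \<noteq> 0}. M_coord f \<alpha> * (if mono_comp m = \<alpha> then 1 else 0))
      = (\<Sum>\<alpha>\<in>{\<alpha>. M_coord f \<alpha> \<noteq> 0}. if mono_comp m = \<alpha> then M_coord f \<alpha> else 0)"
      by (intro sum.cong) auto
    also have "\<dots> = M_coord f (mono_comp m)"
      by (simp add: finite_M_coord)
    finally show ?thesis by (simp add: qcoeff_eq_M_coord)
  qed
  then show ?thesis
    by (simp add: qcoeff_inject[symmetric] fun_eq_iff qcoeff_sum qscale.rep_eq qcoeff_M)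
qed


section \<open>The tensor square\<close>

text \<open>
  The tensor square over \<open>'k\<close> of the \<open>'k\<close>-module of quasisymmetric functions is the free
  \<open>'k\<close>-module on pairs of quasisymmetric functions modulo the submodule \<open>tensor_rel\<close> generated
  by the bilinearity relations.
\<close>

type_synonym 'k free_pairs = "('k qsym \<times> 'k qsym) \<Rightarrow>\<^sub>0 'k"

definition fscale :: "'k::mult_zero \<Rightarrow> ('a \<Rightarrow>\<^sub>0 'k) \<Rightarrow> ('a \<Rightarrow>\<^sub>0 'k)" where
  "fscale c = Poly_Mapping.map ((*) c)"

lemma lookup_fscale: "Poly_Mapping.lookup (fscale c p) i = c * Poly_Mapping.lookup p i"
  by (auto simp: fscale_def Poly_Mapping.map.rep_eq when_def)

lemma fscale_add_right:
  "fscale c (x + y) = fscale c x + (fscale c y :: 'a \<Rightarrow>\<^sub>0 'k::{comm_ring, comm_monoid_mult})"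
  by (rule poly_mapping_eqI) (simp add: lookup_fscale lookup_add distrib_left)

lemma fscale_add_left:
  "fscale (c + d) x = fscale c x + (fscale d x :: 'a \<Rightarrow>\<^sub>0 'k::{comm_ring, comm_monoid_mult})"
  by (rule poly_mapping_eqI) (simp add: lookup_fscale lookup_add distrib_right)

lemma fscale_fscale:
  "fscale c (fscale d x) = (fscale (c * d) x :: 'a \<Rightarrow>\<^sub>0 'k::{comm_ring, comm_monoid_mult})"
  by (rule poly_mapping_eqI) (simp add: lookup_fscale mult.assoc)

lemma fscale_one:
  "fscale 1 x = (x :: 'a \<Rightarrow>\<^sub>0 'k::{comm_ring, comm_monoid_mult})"
  by (rule poly_mapping_eqI) (simp add: lookup_fscale)

abbreviation fpair :: "'k::{comm_ring, comm_monoid_mult} qsym \<Rightarrow> 'k qsym \<Rightarrow> 'k free_pairs" where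
  "fpair f g \<equiv> Poly_Mapping.single (f, g) 1"

inductive_set tensor_rel :: "'k::{comm_ring, comm_monoid_mult} free_pairs set" where
  zero: "0 \<in> tensor_rel"
| add: "x \<in> tensor_rel \<Longrightarrow> y \<in> tensor_rel \<Longrightarrow> x + y \<in> tensor_rel"
| scale: "x \<in> tensor_rel \<Longrightarrow> fscale c x \<in> tensor_rel"
| add_left: "fpair (f + f') g - (fpair f g + fpair f' g) \<in> tensor_rel"
| add_right: "fpair f (g + g') - (fpair f g + fpair f g') \<in> tensor_rel"
| scale_left: "fpair (qscale c f) g - fscale c (fpair f g) \<in> tensor_rel"
| scale_right: "fpair f (qscale c g) - fscale c (fpair f g) \<in> tensor_rel"

lemma tensor_rel_uminus: "x \<in> tensor_rel \<Longrightarrow> - x \<in> tensor_rel"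
proof -
  assume "x \<in> tensor_rel"
  then have "fscale (- 1) x \<in> tensor_rel" by (rule tensor_rel.scale)
  also have "fscale (- 1) x = - x"
    by (rule poly_mapping_eqI) (simp add: lookup_fscale)
  finally show ?thesis .
qed

quotient_type (overloaded) 'k qtensor = "'k::{comm_ring, comm_monoid_mult} free_pairs" /
  "\<lambda>x y. x - y \<in> tensor_rel"
proof (rule equivpI)
  show "reflp (\<lambda>x y :: 'k free_pairs. x - y \<in> tensor_rel)"
    by (rule reflpI) (simp add: tensor_rel.zero)
  show "symp (\<lambda>x y :: 'k free_pairs. x - y \<in> tensor_rel)"
    by (rule sympI) (metis minus_diff_eq tensor_rel_uminus)
  show "transp (\<lambda>x y :: 'k free_pairs. x - y \<in> tensor_rel)"
  proof (rule transpI)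
    fix x y z :: "'k free_pairs"
    assume "x - y \<in> tensor_rel" "y - z \<in> tensor_rel"
    then have "(x - y) + (y - z) \<in> tensor_rel" by (rule tensor_rel.add)
    then show "x - z \<in> tensor_rel" by simp
  qed
qed

instantiation qtensor :: ("{comm_ring, comm_monoid_mult}") ab_group_add
begin

lift_definition zero_qtensor :: "'a qtensor" is 0 .

lift_definition plus_qtensor :: "'a qtensor \<Rightarrow> 'a qtensor \<Rightarrow> 'a qtensor" is "(+)"
proof -
  fix a b c d :: "'a free_pairs"
  assume "a - b \<in> tensor_rel" "c - d \<in> tensor_rel"
  then have "(a - b) + (c - d) \<in> tensor_rel" by (rule tensor_rel.add)
  then show "(a + c) - (b + d) \<in> tensor_rel" by (simp add: algebra_simps)
qed

lift_definition uminus_qtensor :: "'a qtensor \<Rightarrow> 'a qtensor" is uminus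
  using tensor_rel_uminus by fastforce

lift_definition minus_qtensor :: "'a qtensor \<Rightarrow> 'a qtensor \<Rightarrow> 'a qtensor" is "(-)"
proof -
  fix a b c d :: "'a free_pairs"
  assume "a - b \<in> tensor_rel" "c - d \<in> tensor_rel"
  then have "(a - b) + - (c - d) \<in> tensor_rel"
    by (intro tensor_rel.add tensor_rel_uminus)
  then show "(a - c) - (b - d) \<in> tensor_rel" by (simp add: algebra_simps)
qed

instance
proof
  fix a b c :: "'a qtensor"
  show "a + b + c = a + (b + c)"
    by transfer (simp add: add.assoc tensor_rel.zero)
  show "a + b = b + a"
    by transfer (simp add: add.commute tensor_rel.zero)
  show "0 + a = a"
    by transfer (simp add: tensor_rel.zero)
  show "- a + a = 0"
    by transfer (simp add: tensor_rel.zero)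
  show "a - b = a + - b"
    by transfer (simp add: tensor_rel.zero)
qed

end

lift_definition tscale :: "'k::{comm_ring, comm_monoid_mult} \<Rightarrow> 'k qtensor \<Rightarrow> 'k qtensor" is fscale
proof -
  fix c :: 'k and x y :: "'k free_pairs"
  assume "x - y \<in> tensor_rel"
  then have "fscale c (x - y) \<in> tensor_rel" by (rule tensor_rel.scale)
  also have "fscale c (x - y) = fscale c x - fscale c y"
    by (rule poly_mapping_eqI) (simp add: lookup_fscale lookup_minus right_diff_distrib)
  finally show "fscale c x - fscale c y \<in> tensor_rel" .
qed

lift_definition tensor :: "'k::{comm_ring, comm_monoid_mult} qsym \<Rightarrow> 'k qsym \<Rightarrow> 'k qtensor"
  (infixr \<open>\<otimes>\<close> 70) is "\<lambda>f g. fpair f g" .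

lemma tscale_add_right: "tscale c (x + y) = tscale c x + tscale c y"
  by (induction x rule: qtensor.abs_induct; induction y rule: qtensor.abs_induct)
     (simp add: tscale.abs_eq plus_qtensor.abs_eq fscale_add_right)

lemma tscale_add_left: "tscale (c + d) x = tscale c x + tscale d x"
  by (induction x rule: qtensor.abs_induct)
     (simp add: tscale.abs_eq plus_qtensor.abs_eq fscale_add_left)

lemma tscale_tscale: "tscale c (tscale d x) = tscale (c * d) x"
  by (induction x rule: qtensor.abs_induct) (simp add: tscale.abs_eq fscale_fscale)

lemma tscale_one: "tscale 1 x = x"
  by (induction x rule: qtensor.abs_induct) (simp add: tscale.abs_eq fscale_one)

lemma tscale_zero_left: "tscale 0 x = 0"
  using tscale_add_left[of 0 0 x] by simp

lemma tscale_sum: "tscale c (sum F A) = (\<Sum>a\<in>A. tscale c (F a))"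
proof -
  have "tscale c 0 = 0" using tscale_add_right[of c 0 0] by simp
  then show ?thesis
    by (induction A rule: infinite_finite_induct) (simp_all add: tscale_add_right)
qed

lemma tensor_add_left: "(f + f') \<otimes> g = f \<otimes> g + f' \<otimes> g"
  by transfer (rule tensor_rel.add_left)

lemma tensor_add_right: "f \<otimes> (g + g') = f \<otimes> g + f \<otimes> g'"
  by transfer (rule tensor_rel.add_right)

lemma tensor_scale_left: "qscale c f \<otimes> g = tscale c (f \<otimes> g)"
  by transfer (rule tensor_rel.scale_left)

lemma tensor_scale_right: "f \<otimes> qscale c g = tscale c (f \<otimes> g)"
  by transfer (rule tensor_rel.scale_right)


section \<open>The coproduct\<close>

definition qsym_linear :: "('k::{comm_ring, comm_monoid_mult} qsym \<Rightarrow> 'k qtensor) \<Rightarrow> bool" where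
  "qsym_linear D \<longleftrightarrow>
     (\<forall>f g. D (f + g) = D f + D g) \<and> (\<forall>c f. D (qscale c f) = tscale c (D f))"

definition is_coproduct :: "('k::{comm_ring, comm_monoid_mult} qsym \<Rightarrow> 'k qtensor) \<Rightarrow> bool" where
  "is_coproduct D \<longleftrightarrow>
     qsym_linear D \<and> (\<forall>\<alpha>. D (M \<alpha>) = (\<Sum>(\<beta>, \<gamma>)\<in>{(\<beta>, \<gamma>). \<alpha> = cconcat \<beta> \<gamma>}. M \<beta> \<otimes> M \<gamma>))"

text \<open>Existence and uniqueness of the described map are proved in \<open>ex1_coproduct\<close>.\<close>

definition coproduct :: "'k::{comm_ring, comm_monoid_mult} qsym \<Rightarrow> 'k qtensor" where
  "coproduct = (THE D. is_coproduct D)"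

lemma qsym_linear_expansion:
  assumes "qsym_linear D"
  shows "D f = (\<Sum>\<alpha>\<in>{\<alpha>. M_coord f \<alpha> \<noteq> 0}. tscale (M_coord f \<alpha>) (D (M \<alpha>)))"
proof -
  have "D 0 + D 0 = D 0"
    using assms unfolding qsym_linear_def by (metis add_0)
  then have "D (sum F A) = (\<Sum>a\<in>A. D (F a))" for F and A :: "comp set"
    using assms by (induction A rule: infinite_finite_induct) (simp_all add: qsym_linear_def)
  then show ?thesis
    using assms by (subst M_expansion[of f]) (simp add: qsym_linear_def)
qed

lemma ex1_coproduct: "\<exists>!D :: 'k::{comm_ring, comm_monoid_mult} qsym \<Rightarrow> 'k qtensor. is_coproduct D"
proof (rule ex_ex1I)
  fix D E :: "'k qsym \<Rightarrow> 'k qtensor"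
  assume "is_coproduct D" "is_coproduct E"
  then show "D = E"
    using qsym_linear_expansion[of D] qsym_linear_expansion[of E]
    by (simp add: is_coproduct_def fun_eq_iff)
next
  define T :: "comp \<Rightarrow> 'k qtensor"
    where "T \<alpha> = (\<Sum>(\<beta>, \<gamma>)\<in>{(\<beta>, \<gamma>). \<alpha> = cconcat \<beta> \<gamma>}. M \<beta> \<otimes> M \<gamma>)" for \<alpha>
  define S where "S f = {\<alpha>. M_coord f \<alpha> \<noteq> 0}" for f :: "'k qsym"
  define D where "D f = (\<Sum>\<alpha>\<in>S f. tscale (M_coord f \<alpha>) (T \<alpha>))" for f
  have D_eq: "D f = (\<Sum>\<alpha>\<in>A. tscale (M_coord f \<alpha>) (T \<alpha>))" if "finite A" "S f \<subseteq> A" for f A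
    unfolding D_def using that
    by (intro sum.mono_neutral_left) (auto simp: S_def tscale_zero_left)
  have fin: "finite (S f)" for f unfolding S_def by (rule finite_M_coord)
  have "D (f + g) = D f + D g" for f g
  proof -
    have "S (f + g) \<subseteq> S f \<union> S g"
      by (auto simp: S_def M_coord_def plus_qsym.rep_eq)
    then have "D h = (\<Sum>\<alpha>\<in>S f \<union> S g. tscale (M_coord h \<alpha>) (T \<alpha>))" if "h \<in> {f, g, f + g}" for h
      using that by (intro D_eq) (auto simp: fin)
    then show ?thesis
      by (simp add: sum.distrib[symmetric] M_coord_def plus_qsym.rep_eq tscale_add_left)
  qed
  moreover have "D (qscale c f) = tscale c (D f)" for c f
  proof -
    have "S (qscale c f) \<subseteq> S f"
      by (auto simp: S_def M_coord_def qscale.rep_eq)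
    then have "D (qscale c f) = (\<Sum>\<alpha>\<in>S f. tscale (M_coord (qscale c f) \<alpha>) (T \<alpha>))"
      by (intro D_eq fin)
    then show ?thesis
      by (simp add: D_def tscale_sum tscale_tscale M_coord_def qscale.rep_eq)
  qed
  moreover have "D (M \<alpha>) = T \<alpha>" for \<alpha>
  proof -
    have "D (M \<alpha>) = (\<Sum>\<beta>\<in>{\<alpha>}. tscale (M_coord (M \<alpha>) \<beta>) (T \<beta>))"
      by (rule D_eq) (auto simp: S_def M_coord_M split: if_splits)
    then show ?thesis by (simp add: M_coord_M tscale_one)
  qed
  ultimately have "is_coproduct D"
    by (simp add: is_coproduct_def qsym_linear_def T_def)
  then show "\<exists>D :: 'k qsym \<Rightarrow> 'k qtensor. is_coproduct D" by blast
qed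

lemma is_coproduct_coproduct: "is_coproduct coproduct"
  unfolding coproduct_def by (rule theI'[OF ex1_coproduct])


section \<open>The q-analogue of the enriched monomial functions\<close>

text \<open>The index set below is finite by \<open>finite_same_csize\<close>.\<close>

definition eta :: "'k::{comm_ring, comm_monoid_mult} \<Rightarrow> comp \<Rightarrow> 'k qsym" where
  "eta q \<alpha> = (let r = q + 1 in
     \<Sum>\<beta>\<in>{\<beta>. csize \<beta> = csize \<alpha> \<and> descents \<beta> \<subseteq> descents \<alpha>}. qscale (r ^ clength \<beta>) (M \<beta>))"

end

theory Submission
  imports Defs
begin

text \<open>
  Expanding \<^term>\<open>eta q \<alpha>\<close> and applying the coproduct term by term gives the sum of
  \<open>(q + 1) ^ (\<ell>(\<mu>) + \<ell>(\<nu>))\<close> times \<open>M \<mu> \<otimes> M \<nu>\<close> over all pairs \<open>(\<mu>, \<nu>)\<close> whose concatenation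
  \<open>\<mu>\<nu>\<close> coarsens \<open>\<alpha>\<close> (same size, \<open>D(\<mu>\<nu>) \<subseteq> D(\<alpha>)\<close>). Expanding the right-hand side by
  bilinearity gives the same summands, indexed by the ways to write \<open>\<alpha> = \<beta>\<gamma>\<close> and to choose
  coarsenings \<open>\<mu>\<close> of \<open>\<beta>\<close> and \<open>\<nu>\<close> of \<open>\<gamma>\<close>.

  The two index sets agree because coarsening commutes with splitting
  (\<open>coarsens_cconcat_iff\<close>): if \<open>\<mu>\<nu>\<close> coarsens \<open>\<alpha>\<close>, then \<open>|\<mu>|\<close> is a partial sum of \<open>\<mu>\<nu>\<close>,
  hence of \<open>\<alpha>\<close>, so that \<open>\<alpha>\<close> can be cut there, and the two pieces are refinements of \<open>\<mu>\<close>
  and \<open>\<nu>\<close>. The cut is unique, since its position is \<open>|\<mu>|\<close> and the entries of \<open>\<alpha>\<close> are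
  positive (\<open>cconcat_inject\<close>), so every pair is counted once.
\<close>

section \<open>Coarsening and partial sums\<close>

definition coarsens :: "comp \<Rightarrow> comp \<Rightarrow> bool" where
  "coarsens \<beta> \<alpha> \<longleftrightarrow> csize \<beta> = csize \<alpha> \<and> descents \<beta> \<subseteq> descents \<alpha>"

text \<open>
  Adding \<open>0\<close> and \<open>|\<alpha>|\<close> to \<open>D(\<alpha>)\<close> makes concatenation uniform: the point \<open>|\<beta>|\<close> at which
  \<open>\<beta>\<gamma>\<close> is glued belongs to \<open>D(\<beta>\<gamma>)\<close> only if \<open>\<beta>\<close> and \<open>\<gamma>\<close> are nonempty, but it is always a
  partial sum.
\<close>

definition partial_sums :: "comp \<Rightarrow> nat set" where
  "partial_sums \<alpha> = (\<lambda>i. sum_list (take i (parts \<alpha>))) ` {..clength \<alpha>}"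

lemma sum_list_pos_nat: "xs \<noteq> [] \<Longrightarrow> \<forall>x\<in>set xs. 0 < x \<Longrightarrow> 0 < sum_list xs"
  for xs :: "nat list"
  by (cases xs) auto

lemma csize_split:
  "csize \<alpha> = sum_list (take i (parts \<alpha>)) + sum_list (drop i (parts \<alpha>))"
  unfolding csize_def by (metis append_take_drop_id sum_list_append)

lemma descents_bounds:
  assumes "x \<in> descents \<alpha>"
  shows "0 < x" "x < csize \<alpha>"
proof -
  obtain i where i: "x = sum_list (take i (parts \<alpha>))" "1 \<le> i" "i \<le> clength \<alpha> - 1"
    using assms by (auto simp: descents_def)
  have pos: "\<forall>x\<in>set (parts \<alpha>). 0 < x"
    using parts[of \<alpha>] by simp
  have "take i (parts \<alpha>) \<noteq> []" "drop i (parts \<alpha>) \<noteq> []"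
    using i(2,3) by (auto simp: clength_def)
  then show "0 < x" "x < csize \<alpha>"
    using pos i(1) csize_split[of \<alpha> i]
      sum_list_pos_nat[of "take i (parts \<alpha>)"] sum_list_pos_nat[of "drop i (parts \<alpha>)"]
    by (auto dest: in_set_takeD in_set_dropD)
qed

lemma partial_sums_eq: "partial_sums \<alpha> = {0, csize \<alpha>} \<union> descents \<alpha>"
proof -
  have "{..clength \<alpha>} = {0, clength \<alpha>} \<union> {1..clength \<alpha> - 1}"
    by auto
  then show ?thesis
    by (auto simp: partial_sums_def descents_def csize_def clength_def)
qed

lemma coarsens_iff_partial_sums:
  "coarsens \<beta> \<alpha> \<longleftrightarrow> csize \<beta> = csize \<alpha> \<and> partial_sums \<beta> \<subseteq> partial_sums \<alpha>"
  using descents_bounds[of _ \<beta>] by (fastforce simp: coarsens_def partial_sums_eq)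

lemma partial_sums_le_csize: "x \<in> partial_sums \<alpha> \<Longrightarrow> x \<le> csize \<alpha>"
  by (auto simp: partial_sums_def) (metis csize_split le_add1)

lemma clength_cconcat: "clength (cconcat \<beta> \<gamma>) = clength \<beta> + clength \<gamma>"
  by (simp add: clength_def cconcat.rep_eq)

lemma partial_sums_cconcat:
  "partial_sums (cconcat \<beta> \<gamma>) = partial_sums \<beta> \<union> (+) (csize \<beta>) ` partial_sums \<gamma>"
proof -
  have "{..clength \<beta> + clength \<gamma>} = {..clength \<beta>} \<union> (+) (clength \<beta>) ` {..clength \<gamma>}"
    unfolding atLeast0AtMost[symmetric] image_add_atLeastAtMost by auto
  then show ?thesis
    by (simp add: partial_sums_def clength_cconcat cconcat.rep_eq image_Un image_image
        csize_def clength_def)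
qed

section \<open>Coarsening commutes with splitting\<close>

text \<open>
  All partial sums of \<open>\<beta>\<close> are at most \<open>|\<beta>|\<close> and all shifted partial sums of \<open>\<gamma>\<close> are at
  least \<open>|\<beta>|\<close>, so cutting the partial sums of \<open>\<beta>\<gamma>\<close> at \<open>|\<beta>|\<close> recovers both factors.
\<close>

lemma partial_sums_cconcat_left:
  "partial_sums \<beta> = partial_sums (cconcat \<beta> \<gamma>) \<inter> {..csize \<beta>}"
  by (auto simp: partial_sums_cconcat partial_sums_le_csize) (simp add: partial_sums_eq)

lemma partial_sums_cconcat_right:
  "partial_sums \<gamma> = {x. csize \<beta> + x \<in> partial_sums (cconcat \<beta> \<gamma>)}"
proof -
  have "x \<in> partial_sums \<gamma>" if "csize \<beta> + x \<in> partial_sums \<beta>" for x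
    using partial_sums_le_csize[OF that] by (simp add: partial_sums_eq)
  then show ?thesis by (auto simp: partial_sums_cconcat)
qed

lemma partial_sum_cut:
  assumes "x \<in> partial_sums \<alpha>"
  obtains \<beta> \<gamma> where "\<alpha> = cconcat \<beta> \<gamma>" "csize \<beta> = x"
proof -
  obtain i where i: "x = sum_list (take i (parts \<alpha>))"
    using assms by (auto simp: partial_sums_def)
  have "\<forall>x\<in>set (take i (parts \<alpha>)). 0 < x" "\<forall>x\<in>set (drop i (parts \<alpha>)). 0 < x"
    using parts[of \<alpha>] by (auto dest: in_set_takeD in_set_dropD)
  then have p: "parts (Comp (take i (parts \<alpha>))) = take i (parts \<alpha>)"
      "parts (Comp (drop i (parts \<alpha>))) = drop i (parts \<alpha>)"
    by (simp_all add: Comp_inverse)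
  show thesis
  proof
    show "\<alpha> = cconcat (Comp (take i (parts \<alpha>))) (Comp (drop i (parts \<alpha>)))"
      by (simp add: parts_inject[symmetric] cconcat.rep_eq p)
    show "csize (Comp (take i (parts \<alpha>))) = x"
      by (simp add: csize_def p i)
  qed
qed

lemma coarsens_cconcat_iff:
  "coarsens (cconcat \<mu> \<nu>) \<alpha> \<longleftrightarrow>
     (\<exists>\<beta> \<gamma>. \<alpha> = cconcat \<beta> \<gamma> \<and> coarsens \<mu> \<beta> \<and> coarsens \<nu> \<gamma>)"
proof
  assume c: "coarsens (cconcat \<mu> \<nu>) \<alpha>"
  have "csize \<mu> \<in> partial_sums (cconcat \<mu> \<nu>)"
    unfolding partial_sums_cconcat by (simp add: partial_sums_eq)
  then have "csize \<mu> \<in> partial_sums \<alpha>"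
    using c by (auto simp: coarsens_iff_partial_sums)
  then obtain \<beta> \<gamma> where \<alpha>: "\<alpha> = cconcat \<beta> \<gamma>" and \<beta>: "csize \<beta> = csize \<mu>"
    by (rule partial_sum_cut)
  have sub: "partial_sums (cconcat \<mu> \<nu>) \<subseteq> partial_sums (cconcat \<beta> \<gamma>)"
    and \<gamma>: "csize \<gamma> = csize \<nu>"
    using c \<beta> by (auto simp: coarsens_iff_partial_sums \<alpha> csize_cconcat)
  have "partial_sums \<mu> \<subseteq> partial_sums \<beta>"
    using sub \<beta> partial_sums_cconcat_left[of \<mu> \<nu>] partial_sums_cconcat_left[of \<beta> \<gamma>] by auto
  moreover have "partial_sums \<nu> \<subseteq> partial_sums \<gamma>"
    using sub \<beta> partial_sums_cconcat_right[of \<nu> \<mu>] partial_sums_cconcat_right[of \<gamma> \<beta>] by auto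
  ultimately show "\<exists>\<beta> \<gamma>. \<alpha> = cconcat \<beta> \<gamma> \<and> coarsens \<mu> \<beta> \<and> coarsens \<nu> \<gamma>"
    using \<alpha> \<beta> \<gamma> unfolding coarsens_iff_partial_sums by metis
next
  assume "\<exists>\<beta> \<gamma>. \<alpha> = cconcat \<beta> \<gamma> \<and> coarsens \<mu> \<beta> \<and> coarsens \<nu> \<gamma>"
  then show "coarsens (cconcat \<mu> \<nu>) \<alpha>"
    by (auto simp: coarsens_iff_partial_sums csize_cconcat partial_sums_cconcat)
qed

text \<open>
  If \<open>\<beta>\<close> and \<open>\<beta>'\<close> are prefixes of one composition, one of them extends the other by entries
  of sum \<open>0\<close>; these would be positive, so there are none.
\<close>

lemma cconcat_inject:
  assumes "cconcat \<beta> \<gamma> = cconcat \<beta>' \<gamma>'" "csize \<beta> = csize \<beta>'"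
  shows "\<beta> = \<beta>' \<and> \<gamma> = \<gamma>'"
proof -
  have pos: "\<forall>x\<in>set (parts \<alpha>). 0 < x" for \<alpha>
    using parts[of \<alpha>] by simp
  have "parts \<beta> @ parts \<gamma> = parts \<beta>' @ parts \<gamma>'"
    using assms(1) by (metis cconcat.rep_eq)
  then obtain us where us: "parts \<beta> = parts \<beta>' @ us \<and> us @ parts \<gamma> = parts \<gamma>' \<or>
      parts \<beta> @ us = parts \<beta>' \<and> parts \<gamma> = us @ parts \<gamma>'"
    unfolding append_eq_append_conv2 by blast
  then have "csize \<beta> = csize \<beta>' + sum_list us \<or> csize \<beta> + sum_list us = csize \<beta>'"
    unfolding csize_def by (metis sum_list_append)
  then have "sum_list us = 0"
    using assms(2) by simp
  moreover have "\<forall>x\<in>set us. 0 < x"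
    using us pos[of \<beta>] pos[of \<beta>'] by (metis Un_iff set_append)
  ultimately have "us = []"
    using sum_list_pos_nat[of us] by (metis less_irrefl)
  then show ?thesis
    using us by (auto simp: parts_inject)
qed

section \<open>Expansion in the monomial basis\<close>

lemma coproduct_add: "coproduct (f + g) = coproduct f + coproduct g"
  by (metis is_coproduct_coproduct is_coproduct_def qsym_linear_def)

lemma coproduct_qscale: "coproduct (qscale c f) = tscale c (coproduct f)"
  by (metis is_coproduct_coproduct is_coproduct_def qsym_linear_def)

lemma coproduct_M:
  "coproduct (M \<alpha>) = (\<Sum>(\<beta>, \<gamma>)\<in>{(\<beta>, \<gamma>). \<alpha> = cconcat \<beta> \<gamma>}. M \<beta> \<otimes> M \<gamma>)"
  by (rule is_coproduct_coproduct[unfolded is_coproduct_def, THEN conjunct2, THEN spec])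

lemma coproduct_sum: "coproduct (sum F A) = (\<Sum>a\<in>A. coproduct (F a))"
proof -
  have "coproduct 0 = 0"
    using coproduct_add[of 0 0] by simp
  then show ?thesis
    by (induction A rule: infinite_finite_induct) (simp_all add: coproduct_add)
qed

lemma tensor_sum_left: "sum F A \<otimes> g = (\<Sum>a\<in>A. F a \<otimes> g)"
proof -
  have "0 \<otimes> g = 0"
    using tensor_add_left[of 0 0 g] by simp
  then show ?thesis
    by (induction A rule: infinite_finite_induct) (simp_all add: tensor_add_left)
qed

lemma tensor_sum_right: "f \<otimes> sum G B = (\<Sum>b\<in>B. f \<otimes> G b)"
proof -
  have "f \<otimes> 0 = 0"
    using tensor_add_right[of f 0 0] by simp
  then show ?thesis
    by (induction B rule: infinite_finite_induct) (simp_all add: tensor_add_right)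
qed

lemma eta_coarsens: "eta q \<alpha> = (\<Sum>\<beta> | coarsens \<beta> \<alpha>. qscale ((q + 1) ^ clength \<beta>) (M \<beta>))"
  by (simp add: eta_def coarsens_def)

lemma finite_coarsens: "finite {\<beta>. coarsens \<beta> \<alpha>}"
  unfolding coarsens_def by (rule finite_same_csize)

text \<open>
  Both sides of the coproduct formula are sums of \<open>eta_term\<close>; what differs is the index set.
\<close>

definition eta_term :: "'k::{comm_ring, comm_monoid_mult} \<Rightarrow> comp \<times> comp \<Rightarrow> 'k qtensor" where
  "eta_term q = (\<lambda>(\<mu>, \<nu>). tscale ((q + 1) ^ (clength \<mu> + clength \<nu>)) (M \<mu> \<otimes> M \<nu>))"

lemma coproduct_eta:
  "coproduct (eta q \<alpha>) =
     (\<Sum>\<kappa> | coarsens \<kappa> \<alpha>. \<Sum>p\<in>{(\<mu>, \<nu>). \<kappa> = cconcat \<mu> \<nu>}. eta_term q p)"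
  unfolding eta_coarsens coproduct_sum coproduct_qscale coproduct_M tscale_sum
  by (intro sum.cong refl) (auto simp: eta_term_def clength_cconcat)

lemma eta_tensor_eta:
  "eta q \<beta> \<otimes> eta q \<gamma> =
     (\<Sum>p\<in>{\<mu>. coarsens \<mu> \<beta>} \<times> {\<nu>. coarsens \<nu> \<gamma>}. eta_term q p)"
  unfolding eta_coarsens tensor_sum_left
  unfolding tensor_sum_right sum.cartesian_product
  by (intro sum.cong refl)
    (auto simp: eta_term_def tensor_scale_left tensor_scale_right tscale_tscale power_add mult.commute)

section \<open>The coproduct formula\<close>

theorem theorem3p18:
  fixes q :: "'k::{comm_ring, comm_monoid_mult}" and \<alpha> :: comp
  shows "coproduct (eta q \<alpha>) =
    (\<Sum>(\<beta>, \<gamma>)\<in>{(\<beta>, \<gamma>). \<alpha> = cconcat \<beta> \<gamma>}. eta q \<beta> \<otimes> eta q \<gamma>)"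
proof -
  define L where "L = (SIGMA \<kappa>:{\<kappa>. coarsens \<kappa> \<alpha>}. {(\<mu>, \<nu>). \<kappa> = cconcat \<mu> \<nu>})"
  define R where "R = (SIGMA s:{(\<beta>, \<gamma>). \<alpha> = cconcat \<beta> \<gamma>}.
      {\<mu>. coarsens \<mu> (fst s)} \<times> {\<nu>. coarsens \<nu> (snd s)})"
  have "coproduct (eta q \<alpha>) = (\<Sum>x\<in>L. eta_term q (snd x))"
    unfolding coproduct_eta L_def
    by (subst sum.Sigma) (simp_all add: finite_coarsens finite_deconcat, simp add: split_def)
  also have "\<dots> = sum (eta_term q) (snd ` L)"
    by (subst sum.reindex) (auto simp: L_def inj_on_def)
  also have "snd ` L = {(\<mu>, \<nu>). coarsens (cconcat \<mu> \<nu>) \<alpha>}"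
    by (auto simp: L_def image_iff)
  also have "\<dots> = snd ` R"
    unfolding coarsens_cconcat_iff by (force simp: R_def image_iff)
  also have "sum (eta_term q) (snd ` R) = (\<Sum>x\<in>R. eta_term q (snd x))"
  proof -
    \<comment> \<open>The cut of \<open>\<alpha>\<close> can be read off from \<open>\<mu>\<close>, because its left piece has size \<open>|\<mu>|\<close>.\<close>
    have "inj_on snd R"
      by (auto simp: R_def inj_on_def coarsens_def dest: cconcat_inject)
    then show ?thesis
      by (simp add: sum.reindex)
  qed
  also have "\<dots> = (\<Sum>s\<in>{(\<beta>, \<gamma>). \<alpha> = cconcat \<beta> \<gamma>}. eta q (fst s) \<otimes> eta q (snd s))"
    unfolding eta_tensor_eta R_def
    by (subst sum.Sigma) (simp_all add: finite_coarsens finite_deconcat, simp add: split_def)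
  finally show ?thesis
    by (simp add: split_def)
qed

end
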